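(* Let $G$ be an sp-group such that for every prime $p$ the $p$-component $G_p$ is elementary, and write $\prod=\prod_{p\in\mathbb{P}}\mathrm{End}_{\mathbb{Z}}(G_p)$ and $\oplus=\bigoplus_{p\in\mathbb{P}}\mathrm{End}_{\mathbb{Z}}(G_p)$. Let $R$ be a subring of $\prod$ containing $\oplus$. Then $R$ is a pure subring of $\prod$ if and only if there exists a subring $T$ of $\prod$ such that $R=\mathbb{M}_T$, where $$\mathbb{M}_T=\{x\in\textstyle\prod \mid \exists k\in\mathbb{N} \text{ such that } kx\in T\}.$$
   Context: All groups are abelian; $\mathbb{P}$ is the set of primes and $\mathbb{N}$ the set of positive integers. Rings have an identity and a subring of $\prod$ contains the identity of $\prod$. For a group $G$, $G_p$ is its $p$-component (elements of $p$-power order). $G_p$ is elementary if it is a direct sum of cyclic groups of order $p$ (equivalently $pG_p=0$; $G_p=0$ is allowed). A subgroup $H$ of a group $A$ is pure if $nH=H\cap nA$ for all $n\in\mathbb{N}$. A subring of $\prod$ is called pure if its additive group is a pure subgroup of $\prod$. An sp-group is a reduced mixed (neither torsion nor torsion-free) group $G$ with infinitely many nonzero $p$-components such that, for every prime $p$, $G=G_p\oplus B_p$ for some group $B_p$ with $pB_p=B_p$ (equivalently: there are embeddings $\bigoplus_pG_p<G\le\prod_pG_p$ with $G$ pure in $\prod_p G_p$). In general, for a subset $T$ of $\prod$, the paper defines $\mathbb{M}_T=\{x\in\prod\mid\exists k\in\mathbb{N},\ kx\in\oplus+T\}$; when $T$ is closed under multiplication by integers (e.g. a subring) this coincides with the set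 displayed in the claim. *)

theory Defs
  imports "HOL-Algebra.Product_Groups" "HOL-Algebra.Subrings" "HOL-Computational_Algebra.Primes"
begin

text \<open>
  Abelian groups are commutative groups in the sense of HOL-Algebra, hence written
  multiplicatively: \<open>x [^] n\<close> stands for the multiple \<open>n x\<close>, and \<open>\<one>\<close> for the zero element.
\<close>

definition torsion_group :: "('a, 'b) monoid_scheme \<Rightarrow> bool" where
  "torsion_group G \<longleftrightarrow> (\<forall>x\<in>carrier G. \<exists>n::nat. 0 < n \<and> x [^]\<^bsub>G\<^esub> n = \<one>\<^bsub>G\<^esub>)"

definition torsion_free_group :: "('a, 'b) monoid_scheme \<Rightarrow> bool" where
  "torsion_free_group G \<longleftrightarrow>
     (\<forall>x\<in>carrier G. \<forall>n::nat. 0 < n \<longrightarrow> x [^]\<^bsub>G\<^esub> n = \<one>\<^bsub>G\<^esub> \<longrightarrow> x = \<one>\<^bsub>G\<^esub>)"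

definition divisible_subgroup :: "'a set \<Rightarrow> ('a, 'b) monoid_scheme \<Rightarrow> bool" where
  "divisible_subgroup D G \<longleftrightarrow>
     subgroup D G \<and> (\<forall>n::nat. 0 < n \<longrightarrow> (\<lambda>x. x [^]\<^bsub>G\<^esub> n) ` D = D)"

definition reduced_group :: "('a, 'b) monoid_scheme \<Rightarrow> bool" where
  "reduced_group G \<longleftrightarrow> (\<forall>D. divisible_subgroup D G \<longrightarrow> D = {\<one>\<^bsub>G\<^esub>})"

definition p_component :: "('a, 'b) monoid_scheme \<Rightarrow> nat \<Rightarrow> 'a set" where
  "p_component G p = {x \<in> carrier G. \<exists>n::nat. x [^]\<^bsub>G\<^esub> (p ^ n) = \<one>\<^bsub>G\<^esub>}"

abbreviation p_component_group :: "('a, 'b) monoid_scheme \<Rightarrow> nat \<Rightarrow> ('a, 'b) monoid_scheme" where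
  "p_component_group G p \<equiv> G\<lparr>carrier := p_component G p\<rparr>"

text \<open>The last condition is the internal direct decomposition \<open>G = G\<^sub>p \<oplus> B\<close> with \<open>p B = B\<close>.\<close>

definition sp_group :: "('a, 'b) monoid_scheme \<Rightarrow> bool" where
  "sp_group G \<longleftrightarrow>
     comm_group G \<and> reduced_group G \<and> \<not> torsion_group G \<and> \<not> torsion_free_group G \<and>
     infinite {p. prime p \<and> p_component G p \<noteq> {\<one>\<^bsub>G\<^esub>}} \<and>
     (\<forall>p. prime p \<longrightarrow>
        (\<exists>B. subgroup B G \<and>
             p_component G p \<inter> B = {\<one>\<^bsub>G\<^esub>} \<and> p_component G p <#>\<^bsub>G\<^esub> B = carrier G \<and>
             (\<lambda>x. x [^]\<^bsub>G\<^esub> p) ` B = B))"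

text \<open>
  A direct sum of cyclic groups of order \<open>p\<close>. Taking the index set inside the type of elements
  of the group is no restriction: distinct nonzero summands have distinct generators.
  The index set may be empty.
\<close>

definition elementary_p_group :: "nat \<Rightarrow> ('a, 'b) monoid_scheme \<Rightarrow> bool" where
  "elementary_p_group p A \<longleftrightarrow> (\<exists>I :: 'a set. A \<cong> sum_group I (\<lambda>_. integer_mod_group p))"

text \<open>Endomorphisms are made extensional so that equality is equality on the carrier.\<close>

definition endo_ring :: "('a, 'b) monoid_scheme \<Rightarrow> ('a \<Rightarrow> 'a) ring" where
  "endo_ring A =
     \<lparr>carrier = hom A A \<inter> extensional (carrier A),
      monoid.mult = compose (carrier A),
      one = (\<lambda>x\<in>carrier A. x),
      zero = (\<lambda>x\<in>carrier A. \<one>\<^bsub>A\<^esub>),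
      add = (\<lambda>f g. \<lambda>x\<in>carrier A. f x \<otimes>\<^bsub>A\<^esub> g x)\<rparr>"

definition product_ring :: "'i set \<Rightarrow> ('i \<Rightarrow> ('a, 'b) ring_scheme) \<Rightarrow> ('i \<Rightarrow> 'a) ring" where
  "product_ring I R =
     \<lparr>carrier = (\<Pi>\<^sub>E i\<in>I. carrier (R i)),
      monoid.mult = (\<lambda>x y. \<lambda>i\<in>I. x i \<otimes>\<^bsub>R i\<^esub> y i),
      one = (\<lambda>i\<in>I. \<one>\<^bsub>R i\<^esub>),
      zero = (\<lambda>i\<in>I. \<zero>\<^bsub>R i\<^esub>),
      add = (\<lambda>x y. \<lambda>i\<in>I. x i \<oplus>\<^bsub>R i\<^esub> y i)\<rparr>"

definition direct_sum_in_product :: "'i set \<Rightarrow> ('i \<Rightarrow> ('a, 'b) ring_scheme) \<Rightarrow> ('i \<Rightarrow> 'a) set" where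
  "direct_sum_in_product I R =
     {x \<in> carrier (product_ring I R). finite {i \<in> I. x i \<noteq> \<zero>\<^bsub>R i\<^esub>}}"

definition pure_subgroup :: "'a set \<Rightarrow> ('a, 'b) monoid_scheme \<Rightarrow> bool" where
  "pure_subgroup H A \<longleftrightarrow>
     subgroup H A \<and>
     (\<forall>n::nat. 0 < n \<longrightarrow>
        (\<lambda>x. x [^]\<^bsub>A\<^esub> n) ` H = H \<inter> (\<lambda>x. x [^]\<^bsub>A\<^esub> n) ` carrier A)"

text \<open>The library's \<open>subring\<close> contains the identity of the ambient ring.\<close>

definition pure_subring :: "'a set \<Rightarrow> ('a, 'b) ring_scheme \<Rightarrow> bool" where
  "pure_subring S R \<longleftrightarrow> subring S R \<and> pure_subgroup S (add_monoid R)"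

definition prod_End :: "('a, 'b) monoid_scheme \<Rightarrow> (nat \<Rightarrow> 'a \<Rightarrow> 'a) ring" where
  "prod_End G = product_ring {p. prime p} (\<lambda>p. endo_ring (p_component_group G p))"

definition sum_End :: "('a, 'b) monoid_scheme \<Rightarrow> (nat \<Rightarrow> 'a \<Rightarrow> 'a) set" where
  "sum_End G = direct_sum_in_product {p. prime p} (\<lambda>p. endo_ring (p_component_group G p))"

definition M_set :: "('a, 'b) ring_scheme \<Rightarrow> 'a set \<Rightarrow> 'a set" where
  "M_set P T = {x \<in> carrier P. \<exists>k::nat. 0 < k \<and> [k] \<cdot>\<^bsub>P\<^esub> x \<in> T}"

lemma (in comm_group) subgroup_p_component: "subgroup (p_component G p) G"
proof (rule subgroupI)
  show "p_component G p \<subseteq> carrier G" by (auto simp: p_component_def)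
  have "\<one> \<in> p_component G p" by (simp add: p_component_def)
  then show "p_component G p \<noteq> {}" by blast
next
  fix a assume "a \<in> p_component G p"
  then show "inv a \<in> p_component G p"
    by (auto simp: p_component_def nat_pow_inv)
next
  fix a b assume "a \<in> p_component G p" "b \<in> p_component G p"
  then obtain m n :: nat
    where a: "a \<in> carrier G" "a [^] (p ^ m) = \<one>" and b: "b \<in> carrier G" "b [^] (p ^ n) = \<one>"
    by (auto simp: p_component_def)
  have "a [^] (p ^ (m + n)) = \<one>"
    using a nat_pow_pow[of a "p ^ m" "p ^ n"] by (simp add: power_add)
  moreover have "b [^] (p ^ (m + n)) = \<one>"
    using b nat_pow_pow[of b "p ^ n" "p ^ m"] by (simp add: power_add mult.commute)
  ultimately have "(a \<otimes> b) [^] (p ^ (m + n)) = \<one>"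
    using a b by (simp add: nat_pow_distrib)
  then show "a \<otimes> b \<in> p_component G p"
    using a b by (auto simp: p_component_def)
qed

lemma ring_endo_ring:
  assumes "comm_group A"
  shows "ring (endo_ring A)"
proof -
  interpret comm_group A by fact
  show ?thesis
  proof (rule ringI)
    show "abelian_group (endo_ring A)"
    proof (rule abelian_groupI)
      fix f assume f: "f \<in> carrier (endo_ring A)"
      have "(\<lambda>x\<in>carrier A. inv\<^bsub>A\<^esub> f x) \<in> carrier (endo_ring A)"
        using f by (auto simp: endo_ring_def hom_def inv_mult Pi_iff)
      moreover have "(\<lambda>x\<in>carrier A. inv\<^bsub>A\<^esub> f x) \<oplus>\<^bsub>endo_ring A\<^esub> f = \<zero>\<^bsub>endo_ring A\<^esub>"
        using f by (auto simp: endo_ring_def hom_def Pi_iff fun_eq_iff restrict_def)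
      ultimately show "\<exists>g\<in>carrier (endo_ring A). g \<oplus>\<^bsub>endo_ring A\<^esub> f = \<zero>\<^bsub>endo_ring A\<^esub>" by blast
    qed (auto simp: endo_ring_def hom_def Pi_iff fun_eq_iff restrict_def extensional_def m_ac)
    show "Group.monoid (endo_ring A)"
      by (rule monoidI)
        (auto simp: endo_ring_def hom_def Pi_iff fun_eq_iff restrict_def extensional_def compose_def)
  qed (auto simp: endo_ring_def hom_def Pi_iff fun_eq_iff restrict_def extensional_def compose_def)
qed

lemma ring_product_ring:
  assumes "\<And>i. i \<in> I \<Longrightarrow> ring (R i)"
  shows "ring (product_ring I R)"
proof -
  note cl = ring.ring_simprules[OF assms]
  show ?thesis
  proof (rule ringI)
    show "abelian_group (product_ring I R)"
    proof (rule abelian_groupI)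
      fix f assume f: "f \<in> carrier (product_ring I R)"
      have "(\<lambda>i\<in>I. \<ominus>\<^bsub>R i\<^esub> f i) \<in> carrier (product_ring I R)"
        using f by (auto simp: product_ring_def PiE_iff cl)
      moreover have "(\<lambda>i\<in>I. \<ominus>\<^bsub>R i\<^esub> f i) \<oplus>\<^bsub>product_ring I R\<^esub> f = \<zero>\<^bsub>product_ring I R\<^esub>"
        using f by (auto simp: product_ring_def PiE_iff fun_eq_iff restrict_def cl)
      ultimately show "\<exists>g\<in>carrier (product_ring I R).
          g \<oplus>\<^bsub>product_ring I R\<^esub> f = \<zero>\<^bsub>product_ring I R\<^esub>" by blast
    qed (auto simp: product_ring_def PiE_iff fun_eq_iff restrict_def extensional_def cl)
    show "Group.monoid (product_ring I R)"
      by (rule monoidI)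
        (auto simp: product_ring_def PiE_iff fun_eq_iff restrict_def extensional_def cl
          intro: monoid.l_one monoid.r_one ring.is_monoid[OF assms])
  qed (auto simp: product_ring_def PiE_iff fun_eq_iff restrict_def extensional_def cl
      intro: ring.ring_simprules[OF assms])
qed

lemma ring_prod_End:
  assumes "comm_group G"
  shows "ring (prod_End G)"
  unfolding prod_End_def
proof (intro ring_product_ring ring_endo_ring)
  interpret comm_group G by fact
  fix p show "comm_group (p_component_group G p)"
    by (intro group.group_comm_groupI subgroup.subgroup_is_group[OF subgroup_p_component])
      (auto simp: p_component_def m_comm is_group)
qed

end

theory Submission
  imports Defs
begin

text \<open>
  If \<open>R\<close> is pure, then \<open>T = R\<close> works: from \<open>k x \<in> R\<close> purity gives \<open>r \<in> R\<close> with
  \<open>k (x - r) = 0\<close>. Since the component \<open>End(G\<^sub>p)\<close> is killed by \<open>p\<close>, every component of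
  \<open>x - r\<close> at a prime not dividing \<open>k\<close> vanishes, so \<open>x - r\<close> lies in the direct sum, hence in \<open>R\<close>.
  Conversely, \<open>n x \<in> M\<^sub>T\<close> implies \<open>x \<in> M\<^sub>T\<close>, which is purity.
\<close>

text \<open>Multipliers compose: if \<open>k\<close> carries \<open>n x\<close> into
  \<open>T\<close>, then \<open>n * k\<close> carries \<open>x\<close> into \<open>T\<close>, so
  every \<open>n\<close>-th root in \<open>G\<close> of an element of \<open>M_set G T\<close> lies
  in \<open>M_set G T\<close>. The other inclusion is closure of a subgroup under multiples.\<close>

lemma (in abelian_group) subgroup_M_set_pure:
  assumes "subgroup (M_set G T) (add_monoid G)"
  shows "pure_subgroup (M_set G T) (add_monoid G)"
  unfolding pure_subgroup_def
proof (intro conjI assms allI impI)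
  fix n :: nat assume n: "0 < n"
  have "x \<in> M_set G T" if x: "x \<in> carrier G" and nx: "[n] \<cdot> x \<in> M_set G T" for x
  proof -
    obtain k :: nat where k: "0 < k" "[k] \<cdot> ([n] \<cdot> x) \<in> T"
      using nx by (auto simp: M_set_def)
    then have "[(n * k)] \<cdot> x \<in> T"
      using x add.nat_pow_pow[of x k n] by (simp add: mult.commute)
    then show ?thesis
      using x n k(1) by (auto simp: M_set_def intro!: exI[of _ "n * k"])
  qed
  moreover have "[n] \<cdot> x \<in> M_set G T" if "x \<in> M_set G T" for x
  proof -
    interpret M: subgroup "M_set G T" "add_monoid G" by fact
    show ?thesis
      using that M.one_closed M.m_closed by (induction n) (auto simp: add.nat_pow_Suc)
  qed
  moreover have "M_set G T \<subseteq> carrier G"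
    by (auto simp: M_set_def)
  ultimately show "(\<lambda>x. x [^]\<^bsub>add_monoid G\<^esub> n) ` M_set G T =
      M_set G T \<inter> (\<lambda>x. x [^]\<^bsub>add_monoid G\<^esub> n) ` carrier (add_monoid G)"
    unfolding add_pow_def by auto
qed

text \<open>Purity replaces \<open>k x\<close> in \<open>H\<close> by \<open>k r\<close> with
  \<open>r\<close> in \<open>H\<close>; then \<open>x - r\<close> is torsion, hence in
  \<open>H\<close>, and so is \<open>x\<close>.\<close>

lemma (in abelian_group) M_set_pure_subgroup:
  assumes "pure_subgroup H (add_monoid G)"
    and torsion: "\<And>x k. x \<in> carrier G \<Longrightarrow> 0 < (k::nat) \<Longrightarrow> [k] \<cdot> x = \<zero> \<Longrightarrow> x \<in> H"
  shows "M_set G H = H"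
proof
  interpret H: subgroup H "add_monoid G"
    using assms(1) by (simp add: pure_subgroup_def)
  have sub: "H \<subseteq> carrier G" using H.subset by simp
  show "H \<subseteq> M_set G H"
    using sub by (auto simp: M_set_def intro!: exI[of _ "1::nat"])
  show "M_set G H \<subseteq> H"
  proof
    fix x assume "x \<in> M_set G H"
    then obtain k :: nat where x: "x \<in> carrier G" and k: "0 < k" "[k] \<cdot> x \<in> H"
      by (auto simp: M_set_def)
    then have "[k] \<cdot> x \<in> (\<lambda>x. [k] \<cdot> x) ` H"
      using assms(1) by (auto simp: pure_subgroup_def add_pow_def)
    then obtain r where r: "r \<in> H" "[k] \<cdot> x = [k] \<cdot> r"
      by blast
    then have rc: "r \<in> carrier G" using sub by blast
    have "[k] \<cdot> (x \<oplus> \<ominus> r) = \<zero>"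
      using x rc r(2) by (simp add: add.nat_pow_distrib add.nat_pow_inv r_neg)
    then have "x \<oplus> \<ominus> r \<in> H"
      using x rc k(1) by (intro torsion) auto
    then have "x \<oplus> \<ominus> r \<oplus> r \<in> H"
      using r(1) H.m_closed by simp
    then show "x \<in> H"
      using x rc by (simp add: a_assoc l_neg)
  qed
qed

text \<open>In the direct sum each coordinate lies in the integers mod \<open>p\<close>, where the
  \<open>p\<close>-fold multiple is 0; injectivity of the isomorphism carries this back to
  \<open>A\<close>.\<close>

lemma elementary_p_group_pow_eq_one:
  assumes "group A" "elementary_p_group p A" "x \<in> carrier A"
  shows "x [^]\<^bsub>A\<^esub> p = \<one>\<^bsub>A\<^esub>"
proof -
  obtain I :: "'a set" where "A \<cong> sum_group I (\<lambda>_. integer_mod_group p)"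
    using assms(2) by (auto simp: elementary_p_group_def)
  then obtain h where h: "h \<in> iso A (sum_group I (\<lambda>_. integer_mod_group p))"
    by (auto simp: is_iso_def)
  let ?S = "sum_group I (\<lambda>_. integer_mod_group p)"
  interpret A: group A by fact
  interpret S: group ?S by simp
  interpret h: group_hom A ?S h
    using h by unfold_locales (auto simp: iso_def)
  have pow: "y [^]\<^bsub>?S\<^esub> (n::nat) = (\<lambda>i\<in>I. y i [^]\<^bsub>integer_mod_group p\<^esub> n)"
    if "y \<in> carrier ?S" for y n
    using that by (induction n) (auto simp: sum_group_def restrict_def fun_eq_iff)
  have "h x [^]\<^bsub>?S\<^esub> p = \<one>\<^bsub>?S\<^esub>"
    using pow[of "h x" p] assms(3)
    by (simp add: fun_eq_iff)
  then have "h (x [^]\<^bsub>A\<^esub> p) = h \<one>\<^bsub>A\<^esub>"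
    using assms(3) by (simp add: h.hom_nat_pow)
  then show ?thesis
    using h assms(3) by (auto simp: iso_def bij_betw_def inj_on_def)
qed

lemma (in group) coprime_pow_eq_one:
  assumes "x \<in> carrier G" "x [^] (m::nat) = \<one>" "x [^] n = \<one>" "coprime m n"
  shows "x = \<one>"
proof -
  have "ord x dvd m" "ord x dvd n" using assms by (simp_all add: pow_eq_id)
  then have "ord x = 1" using assms(4) by (metis coprime_common_divisor_nat)
  then show ?thesis using assms(1) ord_eq_1 by blast
qed

lemma endo_ring_add_pow:
  assumes "comm_group A" "f \<in> carrier (endo_ring A)" "x \<in> carrier A"
  shows "([(n::nat)] \<cdot>\<^bsub>endo_ring A\<^esub> f) x = f x [^]\<^bsub>A\<^esub> n"
  using assms(2,3) by (induction n) (auto simp: add_pow_def endo_ring_def)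

lemma product_ring_add_pow:
  assumes "i \<in> I"
  shows "([(n::nat)] \<cdot>\<^bsub>product_ring I R\<^esub> x) i = [n] \<cdot>\<^bsub>R i\<^esub> x i"
  using assms by (induction n) (auto simp: add_pow_def product_ring_def)

lemma (in comm_group) comm_group_p_component: "comm_group (p_component_group G p)"
  by (intro group_comm_groupI group.group_comm_groupI subgroup.subgroup_is_group[OF subgroup_p_component])
    (auto simp: p_component_def m_comm is_group)

text \<open>The support of \<open>x\<close> consists of prime divisors of \<open>k\<close>, so it is
  finite. This is where elementarity of the components enters.\<close>

lemma torsion_in_sum_End:
  assumes "comm_group G"
    and elem: "\<And>p. prime p \<Longrightarrow> elementary_p_group p (p_component_group G p)"
    and x: "x \<in> carrier (prod_End G)" and k: "0 < (k::nat)"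
    and kx: "[k] \<cdot>\<^bsub>prod_End G\<^esub> x = \<zero>\<^bsub>prod_End G\<^esub>"
  shows "x \<in> sum_End G"
proof -
  have "p dvd k" if p: "prime p" and nz: "x p \<noteq> \<zero>\<^bsub>endo_ring (p_component_group G p)\<^esub>" for p
  proof (rule ccontr)
    assume "\<not> p dvd k"
    with p have cop: "coprime k p"
      using prime_imp_coprime coprime_commute by blast
    define A where "A = p_component_group G p"
    interpret A: comm_group A
      unfolding A_def by (rule comm_group.comm_group_p_component) fact
    have xp: "x p \<in> carrier (endo_ring A)"
      using x p by (auto simp: prod_End_def product_ring_def A_def)
    have "[k] \<cdot>\<^bsub>endo_ring A\<^esub> x p = \<zero>\<^bsub>endo_ring A\<^esub>"
    proof -
      have "([k] \<cdot>\<^bsub>prod_End G\<^esub> x) p = [k] \<cdot>\<^bsub>endo_ring A\<^esub> x p"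
        unfolding prod_End_def A_def using p by (intro product_ring_add_pow) simp
      moreover have "\<zero>\<^bsub>prod_End G\<^esub> p = \<zero>\<^bsub>endo_ring A\<^esub>"
        using p by (simp add: prod_End_def product_ring_def A_def)
      ultimately show ?thesis using kx by simp
    qed
    \<comment> \<open>Each value of \<open>x p\<close> is annihilated by \<open>k\<close> because
      \<open>k x = 0\<close>, and by \<open>p\<close> because the component is elementary;
      coprimality then makes it trivial.\<close>
    then have "x p a [^]\<^bsub>A\<^esub> k = \<one>\<^bsub>A\<^esub>" if "a \<in> carrier A" for a
      using endo_ring_add_pow[OF A.comm_group_axioms xp that, of k] that
      by (simp add: endo_ring_def)
    moreover have cl: "x p a \<in> carrier A" if "a \<in> carrier A" for a
      using xp that by (auto simp: endo_ring_def hom_def)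
    moreover have "x p a [^]\<^bsub>A\<^esub> p = \<one>\<^bsub>A\<^esub>" if "a \<in> carrier A" for a
      using elementary_p_group_pow_eq_one[OF A.is_group _ cl[OF that]] elem[OF p] by (simp add: A_def)
    ultimately have "x p a = \<one>\<^bsub>A\<^esub>" if "a \<in> carrier A" for a
      using A.coprime_pow_eq_one cop that by blast
    \<comment> \<open>Off the carrier both maps are \<open>undefined\<close> by extensionality, so
      agreement on the carrier is equality.\<close>
    then have "x p = \<zero>\<^bsub>endo_ring A\<^esub>"
      using xp by (auto simp: endo_ring_def fun_eq_iff restrict_def extensional_def)
    with nz show False by (simp add: A_def)
  qed
  then have "{p \<in> {p. prime p}. x p \<noteq> \<zero>\<^bsub>endo_ring (p_component_group G p)\<^esub>} \<subseteq> {p. p dvd k}"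
    by blast
  then have "finite {p \<in> {p. prime p}. x p \<noteq> \<zero>\<^bsub>endo_ring (p_component_group G p)\<^esub>}"
    \<comment> \<open>Positivity of \<open>k\<close> matters: every number divides 0.\<close>
    by (rule finite_subset) (simp add: k)
  then show ?thesis
    using x by (simp add: sum_End_def direct_sum_in_product_def prod_End_def)
qed

theorem proposition7:
  fixes G :: "('a, 'b) monoid_scheme"
    and R :: "(nat \<Rightarrow> 'a \<Rightarrow> 'a) set"
  assumes "sp_group G"
    and "\<And>p. prime p \<Longrightarrow> elementary_p_group p (p_component_group G p)"
    and "subring R (prod_End G)"
    and "sum_End G \<subseteq> R"
  shows "pure_subring R (prod_End G) \<longleftrightarrow>
         (\<exists>T. subring T (prod_End G) \<and> R = M_set (prod_End G) T)"
proof
  have G: "comm_group G" using assms(1) by (simp add: sp_group_def)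
  interpret P: ring "prod_End G" by (rule ring_prod_End[OF G])
  {
    assume "pure_subring R (prod_End G)"
    \<comment> \<open>Torsion elements of the product lie in \<open>sum_End G\<close>, hence in
      \<open>R\<close>.\<close>
    then have "M_set (prod_End G) R = R"
      using torsion_in_sum_End[OF G assms(2)] assms(4)
      by (intro P.M_set_pure_subgroup) (auto simp: pure_subring_def)
    then show "\<exists>T. subring T (prod_End G) \<and> R = M_set (prod_End G) T"
      using assms(3) by blast
  next
    assume "\<exists>T. subring T (prod_End G) \<and> R = M_set (prod_End G) T"
    \<comment> \<open>That \<open>M_set (prod_End G) T\<close> is an additive subgroup comes from
      its equality with the subring \<open>R\<close>.\<close>
    then show "pure_subring R (prod_End G)"
      using P.subgroup_M_set_pure assms(3) subring.axioms(1)[OF assms(3)]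
      by (auto simp: pure_subring_def)
  }
qed

end
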